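(* Let $\vec E=\left(E_0,\frac{x_1}{\rho}E_\rho,\frac{x_2}{\rho}E_\rho\right)$, where $E_0=E_0(x_0,\rho)$ and $E_\rho=E_\rho(x_0,\rho)$ are real-valued $C^1$ functions for $\rho>0$ satisfying $$\rho\left(\frac{\partial E_0}{\partial x_0}+\frac{\partial E_\rho}{\partial\rho}\right)+E_\rho=0,\qquad \frac{\partial E_0}{\partial\rho}=\frac{\partial E_\rho}{\partial x_0}.$$ Then the roots of the characteristic equation of the electric field gradient tensor $\mathbf{J}(\vec E)$ are $$\lambda_0=\frac{E_\rho}{\rho},\qquad \lambda_{1,2}=-\frac{E_\rho}{2\rho}\pm\sqrt{\left(\frac{E_\rho}{2\rho}\right)^2+\frac{E_\rho}{\rho}\frac{\partial E_\rho}{\partial\rho}+\left(\frac{\partial E_\rho}{\partial x_0}\right)^2+\left(\frac{\partial E_\rho}{\partial\rho}\right)^2}.$$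
   Context: Here $\mathbb{R}^3=\{(x_0,x_1,x_2)\}$ and $\rho=\sqrt{x_1^2+x_2^2}>0$. The electric field gradient tensor of $\vec E=(E_0,E_1,E_2)$ is $\mathbf{J}(\vec E)=\left(\frac{\partial E_l}{\partial x_m}\right)_{l,m=0,1,2}$. Its characteristic equation is $\det(\lambda\,\mathrm{Id}-\mathbf{J}(\vec E))=0$ (here of the form $\lambda^3+II\,\lambda-III=0$, since the trace vanishes), and roots are listed with multiplicity. (The stated system describes meridional fields in homogeneous media.) *)

theory Defs
  imports "HOL-Analysis.Analysis" "HOL-Computational_Algebra.Computational_Algebra"
begin

(* Points of the (x0, rho)-half-plane are pairs; points (x0, x1, x2) of space are vectors in
   real^3 whose components are x $ 1, x $ 2, x $ 3, following the library's vector [a, b, c]. *)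

definition half_plane :: "(real \<times> real) set" where
  "half_plane = {(x0, \<rho>). \<rho> > 0}"

definition C1_on :: "('a::real_normed_vector \<Rightarrow> 'b::real_normed_vector) \<Rightarrow> 'a set \<Rightarrow> bool" where
  "C1_on f S \<longleftrightarrow> open S \<and>
     (\<exists>f' :: 'a \<Rightarrow> 'a \<Rightarrow>\<^sub>L 'b.
        (\<forall>z\<in>S. (f has_derivative blinfun_apply (f' z)) (at z)) \<and> continuous_on S f')"

definition deriv_x0 :: "(real \<times> real \<Rightarrow> real) \<Rightarrow> real \<times> real \<Rightarrow> real" where
  "deriv_x0 f z = deriv (\<lambda>t. f (t, snd z)) (fst z)"

definition deriv_rho :: "(real \<times> real \<Rightarrow> real) \<Rightarrow> real \<times> real \<Rightarrow> real" where
  "deriv_rho f z = deriv (\<lambda>t. f (fst z, t)) (snd z)"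

definition rho :: "real^3 \<Rightarrow> real" where
  "rho x = sqrt ((x $ 2)\<^sup>2 + (x $ 3)\<^sup>2)"

definition meridional_field ::
    "(real \<times> real \<Rightarrow> real) \<Rightarrow> (real \<times> real \<Rightarrow> real) \<Rightarrow> real^3 \<Rightarrow> real^3" where
  "meridional_field E0 E\<rho> x =
     vector [E0 (x $ 1, rho x),
             x $ 2 / rho x * E\<rho> (x $ 1, rho x),
             x $ 3 / rho x * E\<rho> (x $ 1, rho x)]"

(* The entry in row l, column m is the partial derivative of the l-th component of E with respect
   to the m-th coordinate. *)
definition gradient_tensor :: "(real^3 \<Rightarrow> real^3) \<Rightarrow> real^3 \<Rightarrow> real^3^3" where
  "gradient_tensor E x = (\<chi> l m. deriv (\<lambda>t. E (x + t *\<^sub>R axis m 1) $ l) 0)"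

(* det (X Id - A) over the polynomial ring, so that its roots carry multiplicities. *)
definition characteristic_poly :: "'a::comm_ring_1^'n^'n \<Rightarrow> 'a poly" where
  "characteristic_poly A = det (mat [:0, 1:] - map_matrix (\<lambda>a. [:a:]) A)"

end

theory Submission
  imports Defs
begin

no_notation fps_nth (infixl "$" 75)

text \<open>
  Put \<open>a = E\<rho> / \<rho>\<close>, \<open>b = \<partial>E\<rho>/\<partial>\<rho>\<close>, \<open>c = \<partial>E\<rho>/\<partial>x0\<close>. The two equations of the system make the
  gradient tensor symmetric and trace-free; a rotation about the \<open>x0\<close>-axis splits it into the
  eigenvalue \<open>a\<close> (the angular direction) and the block with rows \<open>(-(a + b), c)\<close> and \<open>(c, b)\<close> in
  the meridional plane. The block has trace \<open>-a\<close> and determinant \<open>-(a * b + b\<^sup>2 + c\<^sup>2)\<close>, and the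
  discriminant of its characteristic polynomial is \<open>4 * ((a/2 + b)\<^sup>2 + c\<^sup>2) \<ge> 0\<close>.
\<close>

text \<open>Restricting \<open>f\<close> to the two coordinate lines through \<open>z\<close>
  identifies the partials with \<open>D (1, 0)\<close> and \<open>D (0, 1)\<close>; linearity gives
  the rest. This ties the partials, defined through one-variable \<open>deriv\<close>, to the
  Frechet derivative.\<close>

lemma has_derivative_prod_partials:
  assumes "(f has_derivative D) (at z)"
  shows "D (h, k) = h * deriv_x0 f z + k * deriv_rho f z"
proof -
  interpret D: bounded_linear D
    using assms by (rule has_derivative_bounded_linear)
  have "((\<lambda>t. (t, snd z)) has_derivative (\<lambda>h. (h, 0))) (at (fst z))"
    by (intro has_derivative_Pair has_derivative_ident has_derivative_const)
  then have "((\<lambda>t. f (t, snd z)) has_derivative (\<lambda>h. D (h, 0))) (at (fst z))"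
    by (rule has_derivative_compose[where g = f and g' = D]) (use assms in simp)
  moreover have "(\<lambda>h. D (h, 0)) = (*) (D (1, 0))"
  proof
    show "D (h, 0) = D (1, 0) * h" for h
      using D.scaleR[of h "(1, 0)"] by simp
  qed
  ultimately have "((\<lambda>t. f (t, snd z)) has_field_derivative D (1, 0)) (at (fst z))"
    by (simp add: has_field_derivative_def)
  then have x0: "deriv_x0 f z = D (1, 0)"
    unfolding deriv_x0_def by (rule DERIV_imp_deriv)
  have "((\<lambda>t. (fst z, t)) has_derivative (\<lambda>k. (0, k))) (at (snd z))"
    by (intro has_derivative_Pair has_derivative_ident has_derivative_const)
  then have "((\<lambda>t. f (fst z, t)) has_derivative (\<lambda>k. D (0, k))) (at (snd z))"
    by (rule has_derivative_compose[where g = f and g' = D]) (use assms in simp)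
  moreover have "(\<lambda>k. D (0, k)) = (*) (D (0, 1))"
  proof
    show "D (0, k) = D (0, 1) * k" for k
      using D.scaleR[of k "(0, 1)"] by simp
  qed
  ultimately have "((\<lambda>t. f (fst z, t)) has_field_derivative D (0, 1)) (at (snd z))"
    by (simp add: has_field_derivative_def)
  then have rho: "deriv_rho f z = D (0, 1)"
    unfolding deriv_rho_def by (rule DERIV_imp_deriv)
  have "D (h, k) = D (h *\<^sub>R (1, 0) + k *\<^sub>R (0, 1))"
    by simp
  also have "\<dots> = h * D (1, 0) + k * D (0, 1)"
    by (simp only: D.add D.scaleR real_scaleR_def)
  finally show ?thesis
    by (simp add: x0 rho)
qed

lemma C1_on_chain:
  assumes "C1_on f S" and "(p t, q t) \<in> S"
    and p: "(p has_real_derivative p') (at t)" and q: "(q has_real_derivative q') (at t)"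
  shows "((\<lambda>t. f (p t, q t)) has_real_derivative
           p' * deriv_x0 f (p t, q t) + q' * deriv_rho f (p t, q t)) (at t)"
proof -
  obtain D where D: "(f has_derivative D) (at (p t, q t))"
    using assms(1,2) unfolding C1_on_def by blast
  have "((\<lambda>t. (p t, q t)) has_derivative (\<lambda>h. (p' * h, q' * h))) (at t)"
    using p q unfolding has_field_derivative_def by (rule has_derivative_Pair)
  then have "((\<lambda>t. f (p t, q t)) has_derivative (\<lambda>h. D (p' * h, q' * h))) (at t)"
    by (rule has_derivative_compose) (rule D)
  then show ?thesis
    unfolding has_field_derivative_def has_derivative_prod_partials[OF D]
    by (rule has_derivative_eq_rhs) (simp add: fun_eq_iff algebra_simps)
qed

lemma has_real_derivative_component_line:
  "((\<lambda>t. (x + t *\<^sub>R d) $ i) has_real_derivative d $ i) (at t)"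
  by (auto intro!: derivative_eq_intros)

text \<open>Off the axis the radicand is positive, so the square root is differentiable there and
  the chain rule applies.\<close>

lemma has_real_derivative_rho_line:
  assumes "rho x > 0"
  shows "((\<lambda>t. rho (x + t *\<^sub>R d)) has_real_derivative
           (x $ 2 * d $ 2 + x $ 3 * d $ 3) / rho x) (at 0)"
proof -
  have pos: "(x $ 2)\<^sup>2 + (x $ 3)\<^sup>2 > 0"
    using assms by (simp add: rho_def)
  have "((\<lambda>t. ((x + t *\<^sub>R d) $ 2)\<^sup>2 + ((x + t *\<^sub>R d) $ 3)\<^sup>2) has_real_derivative
      2 * (x $ 2 * d $ 2 + x $ 3 * d $ 3)) (at 0)"
    by (auto intro!: derivative_eq_intros)
  from DERIV_chain2[OF DERIV_real_sqrt this] show ?thesis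
    unfolding rho_def by (rule DERIV_cong) (use pos in \<open>simp_all add: divide_simps\<close>)
qed

text \<open>\<open>(u, v)\<close> is the unit radial direction. Differentiating this direction
  contributes \<open>a\<close> times the angular projection to the lower right block;
  differentiating the amplitude \<open>E\<rho>\<close> contributes
  \<open>deriv_rho E\<rho> z\<close> times the radial projection.\<close>

lemma gradient_tensor_meridional_field:
  fixes x :: "real^3"
  assumes C1: "C1_on E0 half_plane" "C1_on E\<rho> half_plane" and pos: "rho x > 0"
  defines "z \<equiv> (x $ 1, rho x)"
  defines "u \<equiv> x $ 2 / rho x" and "v \<equiv> x $ 3 / rho x" and "a \<equiv> E\<rho> z / rho x"
  shows "gradient_tensor (meridional_field E0 E\<rho>) x = vector
    [vector [deriv_x0 E0 z, u * deriv_rho E0 z, v * deriv_rho E0 z],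
     vector [u * deriv_x0 E\<rho> z, a * (1 - u\<^sup>2) + u\<^sup>2 * deriv_rho E\<rho> z, u * v * (deriv_rho E\<rho> z - a)],
     vector [v * deriv_x0 E\<rho> z, u * v * (deriv_rho E\<rho> z - a), a * (1 - v\<^sup>2) + v\<^sup>2 * deriv_rho E\<rho> z]]"
proof -
  \<comment> \<open>\<open>r' d\<close> is the derivative of \<open>rho\<close> in direction
    \<open>d\<close>, and \<open>f' f d\<close> that of \<open>f\<close> taken at
    \<open>(x $ 1, rho x)\<close>.\<close>
  define r' where "r' d = u * d $ 2 + v * d $ 3" for d :: "real^3"
  define f' where "f' f d = d $ 1 * deriv_x0 f z + r' d * deriv_rho f z" for f and d :: "real^3"
  have rho: "((\<lambda>t. rho (x + t *\<^sub>R d)) has_real_derivative r' d) (at 0)" for d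
    using has_real_derivative_rho_line[OF pos, of d]
    by (simp add: r'_def u_def v_def add_divide_distrib)
  have comp: "((\<lambda>t. f ((x + t *\<^sub>R d) $ 1, rho (x + t *\<^sub>R d))) has_real_derivative f' f d) (at 0)"
    if "C1_on f half_plane" for f d
    using C1_on_chain[OF that _ has_real_derivative_component_line rho, of x d 1] pos
    by (simp add: f'_def z_def half_plane_def)
  \<comment> \<open>The two terms with \<open>a\<close> come from the quotient
    \<open>x $ i / rho x\<close>, the last one from \<open>E\<rho>\<close>.\<close>
  have ang: "((\<lambda>t. (x + t *\<^sub>R d) $ i / rho (x + t *\<^sub>R d) * E\<rho> ((x + t *\<^sub>R d) $ 1, rho (x + t *\<^sub>R d)))
      has_real_derivative a * d $ i - a * (x $ i / rho x) * r' d + x $ i / rho x * f' E\<rho> d) (at 0)"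
    for d i
  proof -
    have "(((\<lambda>t. (x + t *\<^sub>R d) $ i / rho (x + t *\<^sub>R d))) has_real_derivative
        (d $ i * rho x - x $ i * r' d) / (rho x * rho x)) (at 0)"
      using DERIV_divide[OF has_real_derivative_component_line[of x d i 0] rho[of d]] pos by simp
    from DERIV_mult[OF this comp[OF C1(2), of d]] show ?thesis
      by (rule DERIV_cong) (use pos in \<open>simp add: a_def z_def field_simps\<close>)
  qed
  have "gradient_tensor (meridional_field E0 E\<rho>) x $ l $ m =
      (if l = 1 then f' E0 (axis m 1)
       else a * axis m 1 $ l - a * (x $ l / rho x) * r' (axis m 1)
              + x $ l / rho x * f' E\<rho> (axis m 1))" for l m
    using exhaust_3[of l] DERIV_imp_deriv[OF comp[OF C1(1)]] DERIV_imp_deriv[OF ang]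
    by (auto simp: gradient_tensor_def meridional_field_def)
  then show ?thesis
    by (simp add: vec_eq_iff forall_3 f'_def r'_def axis_def flip: u_def v_def)
      (simp add: algebra_simps power2_eq_square)
qed

lemma characteristic_poly_meridional:
  fixes a b c u v :: real
  assumes uv: "u\<^sup>2 + v\<^sup>2 = 1"
  shows "characteristic_poly (vector
      [vector [- (a + b), u * c, v * c],
       vector [u * c, a * (1 - u\<^sup>2) + u\<^sup>2 * b, u * v * (b - a)],
       vector [v * c, u * v * (b - a), a * (1 - v\<^sup>2) + v\<^sup>2 * b]] :: real^3^3) =
    [:- a, 1:] * [:- (a * b + b\<^sup>2 + c\<^sup>2), a, 1:]"
    (is "?P = ?Q")
proof -
  have v: "v\<^sup>2 = 1 - u\<^sup>2"
    using uv by simp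
  \<comment> \<open>Real polynomials agreeing at every point are equal, so the determinant can be
    expanded in real arithmetic. Only even powers of \<open>u\<close> and \<open>v\<close> survive,
    and the substitution for the square of \<open>v\<close> then eliminates
    \<open>v\<close>.\<close>
  have "poly ?P t = poly ?Q t" for t
  proof -
    have "poly ?P t =
      (t + a + b) * ((t - a * (1 - u\<^sup>2) - u\<^sup>2 * b) * (t - a * (1 - v\<^sup>2) - v\<^sup>2 * b)
                       - u\<^sup>2 * v\<^sup>2 * (b - a)\<^sup>2)
      - u\<^sup>2 * c\<^sup>2 * (t - a * (1 - v\<^sup>2) - v\<^sup>2 * b) - v\<^sup>2 * c\<^sup>2 * (t - a * (1 - u\<^sup>2) - u\<^sup>2 * b)
      - 2 * u\<^sup>2 * v\<^sup>2 * c\<^sup>2 * (b - a)"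
      by (simp add: characteristic_poly_def det_3 mat_def map_matrix_def)
        (simp add: algebra_simps power2_eq_square)
    also have "\<dots> = poly ?Q t"
      unfolding v by (simp add: algebra_simps power2_eq_square)
    finally show ?thesis .
  qed
  then show ?thesis
    by (simp add: poly_eq_poly_eq_iff[symmetric] fun_eq_iff)
qed

text \<open>A nonnegative discriminant splits the quadratic over the reals, and
  \<open>proots\<close> turns products of nonzero polynomials into multiset sums, so coinciding
  roots keep their multiplicity.\<close>

lemma proots_linear_times_quadratic:
  fixes a p q :: real
  assumes "(p / 2)\<^sup>2 - q \<ge> 0"
  shows "proots ([:- a, 1:] * [:q, p, 1:]) =
    {# a, - p / 2 + sqrt ((p / 2)\<^sup>2 - q), - p / 2 - sqrt ((p / 2)\<^sup>2 - q) #}"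
proof -
  define s where "s = sqrt ((p / 2)\<^sup>2 - q)"
  have "s * s = (p / 2)\<^sup>2 - q"
    using assms by (simp add: s_def)
  \<comment> \<open>Completing the square: the quadratic is the square of X + p/2 minus the square
    of \<open>s\<close>.\<close>
  then have fact: "[:q, p, 1:] = [:- (- p / 2 + s), 1:] * [:- (- p / 2 - s), 1:]"
    by (simp add: field_simps power2_eq_square)
  have lin: "proots [:- r, 1:] = {#r#}" for r :: real
    by simp
  show ?thesis
    unfolding fact s_def[symmetric]
    by (subst proots_mult, simp, simp, subst proots_mult, simp, simp) (simp only: lin, simp)
qed

theorem corollary7p1:
  fixes E0 E\<rho> :: "real \<times> real \<Rightarrow> real"
  assumes "C1_on E0 half_plane" and "C1_on E\<rho> half_plane"
    and "\<And>x0 \<rho>. \<rho> > 0 \<Longrightarrow>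
           \<rho> * (deriv_x0 E0 (x0, \<rho>) + deriv_rho E\<rho> (x0, \<rho>)) + E\<rho> (x0, \<rho>) = 0"
    and "\<And>x0 \<rho>. \<rho> > 0 \<Longrightarrow> deriv_rho E0 (x0, \<rho>) = deriv_x0 E\<rho> (x0, \<rho>)"
  shows "\<forall>x :: real^3. rho x > 0 \<longrightarrow>
    (let \<rho> = rho x;
         z = (x $ 1, \<rho>);
         D = (E\<rho> z / (2 * \<rho>))\<^sup>2 + E\<rho> z / \<rho> * deriv_rho E\<rho> z
               + (deriv_x0 E\<rho> z)\<^sup>2 + (deriv_rho E\<rho> z)\<^sup>2
     in proots (characteristic_poly (gradient_tensor (meridional_field E0 E\<rho>) x)) =
          {# E\<rho> z / \<rho>, - E\<rho> z / (2 * \<rho>) + sqrt D, - E\<rho> z / (2 * \<rho>) - sqrt D #})"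
proof (intro allI impI)
  fix x :: "real^3"
  assume pos: "rho x > 0"
  define z where "z = (x $ 1, rho x)"
  define a where "a = E\<rho> z / rho x"
  define b where "b = deriv_rho E\<rho> z"
  define c where "c = deriv_x0 E\<rho> z"
  define u where "u = x $ 2 / rho x"
  define v where "v = x $ 3 / rho x"
  \<comment> \<open>The first equation of the system, divided by \<open>rho x\<close>.\<close>
  have "deriv_x0 E0 z = - (a + b)"
    using assms(3)[OF pos, of "x $ 1"] pos by (simp add: a_def b_def z_def field_simps)
  moreover have "deriv_rho E0 z = c"
    using assms(4)[OF pos] by (simp add: c_def z_def)
  moreover have "u\<^sup>2 + v\<^sup>2 = 1"
  proof -
    have "(rho x)\<^sup>2 = (x $ 2)\<^sup>2 + (x $ 3)\<^sup>2"
      by (simp add: rho_def)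
    moreover have "(rho x)\<^sup>2 \<noteq> 0"
      using pos by simp
    ultimately show ?thesis
      by (simp only: u_def v_def power_divide flip: add_divide_distrib) simp
  qed
  ultimately have "characteristic_poly (gradient_tensor (meridional_field E0 E\<rho>) x) =
      [:- a, 1:] * [:- (a * b + b\<^sup>2 + c\<^sup>2), a, 1:]"
    using gradient_tensor_meridional_field[OF assms(1,2) pos] characteristic_poly_meridional[of u v a b c]
    by (simp flip: a_def b_def c_def u_def v_def z_def)
  \<comment> \<open>Writing the radicand as a sum of two squares shows that it is nonnegative, as
    the root lemma requires.\<close>
  moreover have "(a / 2)\<^sup>2 - (- (a * b + b\<^sup>2 + c\<^sup>2)) = (a / 2 + b)\<^sup>2 + c\<^sup>2"
    by (simp add: algebra_simps power2_eq_square)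
  ultimately have "proots (characteristic_poly (gradient_tensor (meridional_field E0 E\<rho>) x)) =
      {# a, - a / 2 + sqrt ((a / 2)\<^sup>2 - (- (a * b + b\<^sup>2 + c\<^sup>2))),
         - a / 2 - sqrt ((a / 2)\<^sup>2 - (- (a * b + b\<^sup>2 + c\<^sup>2))) #}"
    by (simp only: proots_linear_times_quadratic sum_power2_ge_zero)
  moreover have "(a / 2)\<^sup>2 - (- (a * b + b\<^sup>2 + c\<^sup>2)) = (E\<rho> z / (2 * rho x))\<^sup>2
      + E\<rho> z / rho x * deriv_rho E\<rho> z + (deriv_x0 E\<rho> z)\<^sup>2 + (deriv_rho E\<rho> z)\<^sup>2"
    by (simp add: a_def b_def c_def mult.commute)
  moreover have "- a / 2 = - E\<rho> z / (2 * rho x)"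
    by (simp add: a_def)
  ultimately show "let \<rho> = rho x;
         z = (x $ 1, \<rho>);
         D = (E\<rho> z / (2 * \<rho>))\<^sup>2 + E\<rho> z / \<rho> * deriv_rho E\<rho> z
               + (deriv_x0 E\<rho> z)\<^sup>2 + (deriv_rho E\<rho> z)\<^sup>2
     in proots (characteristic_poly (gradient_tensor (meridional_field E0 E\<rho>) x)) =
          {# E\<rho> z / \<rho>, - E\<rho> z / (2 * \<rho>) + sqrt D, - E\<rho> z / (2 * \<rho>) - sqrt D #}"
    by (simp only: Let_def a_def z_def)
qed

end
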